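(* Let $X$ be a nonempty locally compact Hausdorff space and let $(Y,d)$ be a metric space with at least two points. The following conditions are equivalent: (1) $MU(X,Y)$ is metrizable; (2) $MU(X,Y)$ is first countable; (3) $MU(X,Y)$ is Fréchet-Urysohn; (4) $MU(X,Y)$ is sequential; (5) $MU(X,Y)$ has countable tightness; (6) $X$ is hemicompact.
   Context: A map (multifunction) $F\colon X\to Y$ assigns to each $x\in X$ a subset $F(x)\subseteq Y$; for $A\subseteq X$ put $F(A)=\bigcup_{x\in A}F(x)$. Maps are identified with their graphs $\{(x,y): y\in F(x)\}$. $F$ is upper semicontinuous if for every $x\in X$ and every open $V\supseteq F(x)$ there is an open $U\ni x$ with $F(U)\subseteq V$. $F$ is usco if it is upper semicontinuous and every $F(x)$ is a nonempty compact set. $F$ is minimal usco if it is usco and its graph does not properly contain the graph of any other usco map from $X$ to $Y$. $MU(X,Y)$ is the set of all minimal usco maps from $X$ to $Y$. Let $K(Y)$ be the set of nonempty compact subsets of $Y$, and $H_d$ the Hausdorff metric on $K(Y)$. On $K(Y)^X$ the topology $\tau_{uc}$ of uniform convergence on compact sets is induced by the uniformity $\mathcal U_{uc}$ with base consisting of the sets $W[K,\varepsilon]=\{(F,G): H_d(F(x),G(x))<\varepsilon \text{ for every } x\in K\}$, where $K\subseteq X$ is compact and $\varepsilon>0$. $MU(X,Y)\subseteq K(Y)^X$ carries the subspace topology of $\tau_{uc}$. A space $Z$ is: Fréchet-Urysohn if for every $E\subseteq Z$ and $z\in\overline{E}$ there is a sequence in $E$ converging to $z$; sequential if for every non-closed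 $A\subseteq Z$ there is a convergent sequence in $A$ whose limit is not in $A$; of countable tightness if for every $A\subseteq Z$ and $z\in\overline{A}$ there is a countable $A_0\subseteq A$ with $z\in\overline{A_0}$; hemicompact if the family $K(Z)$ of nonempty compact subsets of $Z$, ordered by inclusion, has a countable cofinal subfamily. *)

theory Defs
  imports "HOL-Analysis.Analysis"
begin

section \<open>Usco maps\<close>

text \<open>A multifunction from \<open>X\<close> to \<open>Y\<close> is a function of type \<open>'a \<Rightarrow> 'b set\<close>, where the
  spaces \<open>X\<close> and \<open>Y\<close> are the types \<open>'a\<close> and \<open>'b\<close> with their type-class topologies.\<close>

definition graph_of :: "('a \<Rightarrow> 'b set) \<Rightarrow> ('a \<times> 'b) set" where
  "graph_of F = {(x, y). y \<in> F x}"

definition upper_semicontinuous ::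
    "('a::topological_space \<Rightarrow> 'b::topological_space set) \<Rightarrow> bool" where
  "upper_semicontinuous F \<longleftrightarrow>
     (\<forall>x V. open V \<and> F x \<subseteq> V \<longrightarrow> (\<exists>U. open U \<and> x \<in> U \<and> (\<Union>u\<in>U. F u) \<subseteq> V))"

definition usco :: "('a::topological_space \<Rightarrow> 'b::topological_space set) \<Rightarrow> bool" where
  "usco F \<longleftrightarrow> upper_semicontinuous F \<and> (\<forall>x. F x \<noteq> {} \<and> compact (F x))"

definition minimal_usco :: "('a::topological_space \<Rightarrow> 'b::topological_space set) \<Rightarrow> bool" where
  "minimal_usco F \<longleftrightarrow> usco F \<and> (\<nexists>G. usco G \<and> graph_of G \<subset> graph_of F)"


section \<open>Uniform convergence on compact sets\<close>

text \<open>For nonempty compact sets the suprema and the infima hidden in \<^const>\<open>infdist\<close> are taken over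
  nonempty bounded sets of reals; the value at other sets is never used.\<close>

definition hausdorff_metric :: "'b::metric_space set \<Rightarrow> 'b set \<Rightarrow> real" where
  "hausdorff_metric A B = max (SUP a\<in>A. infdist a B) (SUP b\<in>B. infdist b A)"

definition compact_valued_maps :: "('a \<Rightarrow> 'b::metric_space set) set" where
  "compact_valued_maps = {F. \<forall>x. F x \<noteq> {} \<and> compact (F x)}"

definition uc_entourage ::
    "'a set \<Rightarrow> real \<Rightarrow> (('a \<Rightarrow> 'b::metric_space set) \<times> ('a \<Rightarrow> 'b set)) set" where
  "uc_entourage K \<epsilon> =
     {(F, G). F \<in> compact_valued_maps \<and> G \<in> compact_valued_maps \<and>
              (\<forall>x\<in>K. hausdorff_metric (F x) (G x) < \<epsilon>)}"

text \<open>The topology induced by the uniformity with base \<^const>\<open>uc_entourage\<close>: a set is open iff with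
  each \<open>F\<close> it contains \<open>W[F] = {G. (F, G) \<in> W}\<close> for some basic entourage \<open>W\<close>.\<close>

definition uc_topology :: "('a::topological_space \<Rightarrow> 'b::metric_space set) topology" where
  "uc_topology = topology (\<lambda>\<U>. \<U> \<subseteq> compact_valued_maps \<and>
     (\<forall>F\<in>\<U>. \<exists>K \<epsilon>. compact K \<and> 0 < \<epsilon> \<and> uc_entourage K \<epsilon> `` {F} \<subseteq> \<U>))"

lemma openin_uc_topology:
  fixes \<U> :: "('a::topological_space \<Rightarrow> 'b::metric_space set) set"
  shows "openin uc_topology \<U> \<longleftrightarrow> \<U> \<subseteq> compact_valued_maps \<and>
     (\<forall>F\<in>\<U>. \<exists>K \<epsilon>. compact K \<and> 0 < \<epsilon> \<and> uc_entourage K \<epsilon> `` {F} \<subseteq> \<U>)"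
proof -
  let ?P = "\<lambda>\<U> :: ('a \<Rightarrow> 'b set) set. \<U> \<subseteq> compact_valued_maps \<and>
     (\<forall>F\<in>\<U>. \<exists>K \<epsilon>. compact K \<and> 0 < \<epsilon> \<and> uc_entourage K \<epsilon> `` {F} \<subseteq> \<U>)"
  have "istopology ?P"
    unfolding istopology_def
  proof (intro conjI allI impI)
    fix S T assume S: "?P S" and T: "?P T"
    show "S \<inter> T \<subseteq> compact_valued_maps"
      using S by blast
    show "\<forall>F\<in>S \<inter> T. \<exists>K \<epsilon>. compact K \<and> 0 < \<epsilon> \<and> uc_entourage K \<epsilon> `` {F} \<subseteq> S \<inter> T"
    proof
      fix F assume "F \<in> S \<inter> T"
      then obtain K \<epsilon> L \<delta> where "compact K" "0 < \<epsilon>" "uc_entourage K \<epsilon> `` {F} \<subseteq> S"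
        and "compact L" "0 < \<delta>" "uc_entourage L \<delta> `` {F} \<subseteq> T"
        using S T by (metis IntD1 IntD2)
      moreover have "uc_entourage (K \<union> L) (min \<epsilon> \<delta>) `` {F} \<subseteq>
          uc_entourage K \<epsilon> `` {F} \<inter> uc_entourage L \<delta> `` {F}"
        by (auto simp: uc_entourage_def)
      ultimately show "\<exists>K \<epsilon>. compact K \<and> 0 < \<epsilon> \<and> uc_entourage K \<epsilon> `` {F} \<subseteq> S \<inter> T"
        by (intro exI[of _ "K \<union> L"] exI[of _ "min \<epsilon> \<delta>"]) (auto intro: compact_Un)
    qed
  next
    fix \<K> assume \<K>: "\<forall>S\<in>\<K>. ?P S"
    then show "\<Union>\<K> \<subseteq> compact_valued_maps"
      by blast
    show "\<forall>F\<in>\<Union>\<K>. \<exists>K \<epsilon>. compact K \<and> 0 < \<epsilon> \<and> uc_entourage K \<epsilon> `` {F} \<subseteq> \<Union>\<K>"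
      using \<K> by (meson Union_iff Union_upper subset_trans)
  qed
  then show ?thesis
    by (simp add: uc_topology_def topology_inverse')
qed

lemma topspace_uc_topology [simp]: "topspace uc_topology = compact_valued_maps"
proof
  show "topspace uc_topology \<subseteq> compact_valued_maps"
    using openin_topspace openin_uc_topology by blast
  have "openin uc_topology compact_valued_maps"
    unfolding openin_uc_topology
    by (auto simp: uc_entourage_def intro!: exI[of _ "{}"] exI[of _ "1::real"])
  then show "compact_valued_maps \<subseteq> topspace uc_topology"
    by (rule openin_subset)
qed

definition MU :: "('a::topological_space \<Rightarrow> 'b::metric_space set) topology" where
  "MU = subtopology uc_topology {F. minimal_usco F}"

lemma topspace_MU [simp]: "topspace MU = {F. minimal_usco F}"
  by (auto simp: MU_def compact_valued_maps_def minimal_usco_def usco_def)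


section \<open>Countability properties of topological spaces\<close>

definition Frechet_Urysohn_space :: "'a topology \<Rightarrow> bool" where
  "Frechet_Urysohn_space Z \<longleftrightarrow>
     (\<forall>E z. E \<subseteq> topspace Z \<and> z \<in> Z closure_of E \<longrightarrow>
        (\<exists>s :: nat \<Rightarrow> 'a. range s \<subseteq> E \<and> limitin Z s z sequentially))"

definition sequential_space :: "'a topology \<Rightarrow> bool" where
  "sequential_space Z \<longleftrightarrow>
     (\<forall>A. A \<subseteq> topspace Z \<and> \<not> closedin Z A \<longrightarrow>
        (\<exists>(s :: nat \<Rightarrow> 'a) z. range s \<subseteq> A \<and> limitin Z s z sequentially \<and> z \<notin> A))"

definition countable_tightness :: "'a topology \<Rightarrow> bool" where
  "countable_tightness Z \<longleftrightarrow>
     (\<forall>A z. A \<subseteq> topspace Z \<and> z \<in> Z closure_of A \<longrightarrow>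
        (\<exists>A\<^sub>0. A\<^sub>0 \<subseteq> A \<and> countable A\<^sub>0 \<and> z \<in> Z closure_of A\<^sub>0))"

definition hemicompact_space :: "'a topology \<Rightarrow> bool" where
  "hemicompact_space Z \<longleftrightarrow>
     (\<exists>\<C>. countable \<C> \<and> \<C> \<subseteq> {K. compactin Z K \<and> K \<noteq> {}} \<and>
        (\<forall>K. compactin Z K \<and> K \<noteq> {} \<longrightarrow> (\<exists>C\<in>\<C>. K \<subseteq> C)))"

end

theory Submission
  imports Defs
begin

text \<open>The chain (1) \<open>\<Longrightarrow>\<close> (2) \<open>\<Longrightarrow>\<close> (3) \<open>\<Longrightarrow>\<close> (4) \<open>\<Longrightarrow>\<close> (5) holds in every topological space, so the
  theorem rests on (5) \<open>\<Longrightarrow>\<close> (6) and (6) \<open>\<Longrightarrow>\<close> (1).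

  (5) \<open>\<Longrightarrow>\<close> (6). Fix points \<open>a \<noteq> b\<close> of \<open>Y\<close>. An open set \<open>U\<close> gives a minimal usco map
  \<^term>\<open>two_valued_usco a b U\<close>, which is \<open>{a}\<close> on \<open>U\<close>, \<open>{b}\<close> off the closure of \<open>U\<close>, and contains \<open>a\<close>
  exactly on that closure (\<open>minimal_usco_two_valued_usco\<close>). By local compactness every compact
  \<open>K\<close> lies in an open \<open>U\<close> with compact closure, and then this map agrees on \<open>K\<close> with the constant map
  \<open>{a}\<close>. Hence the constant map is in the closure of the family of all these maps. By tightness it
  is in the closure of countably many of them, given by \<open>U\<^sub>0, U\<^sub>1, \<dots>\<close>. A map that
  is closer to \<open>{a}\<close> on \<open>K\<close> than \<open>dist a b\<close> omits \<open>b\<close> on \<open>K\<close>, and so \<open>K\<close> lies in the closure of its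
  \<open>U\<^sub>n\<close>: these closures are cofinal among the compact sets.

  (6) \<open>\<Longrightarrow>\<close> (1). A countable cofinal family of compact sets \<open>C\<^sub>0, C\<^sub>1, \<dots>\<close> yields the weight
  \<open>w x = 1 / (n + 1)\<close>, where \<open>n\<close> is the first index with \<open>x \<in> C\<^sub>n\<close>. It is bounded away from
  \<open>0\<close> on each compact set, and exceeds each \<open>\<epsilon> > 0\<close> only within a compact set. Therefore the single
  metric \<open>sup\<^sub>x min (w x) (H (F x) (G x))\<close>, with \<open>H\<close> the Hausdorff metric, induces uniform convergence
  on compact sets (\<open>metrizable_uc_topology_if_weight\<close>), and metrizability passes to the subspace of
  minimal usco maps.\<close>

section \<open>The Hausdorff metric on nonempty compact sets\<close>

lemma bdd_above_infdist_image:
  fixes A B :: "'a::metric_space set"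
  assumes "compact A"
  shows "bdd_above ((\<lambda>a. infdist a B) ` A)"
  by (intro bounded_imp_bdd_above compact_imp_bounded compact_continuous_image continuous_intros
      assms)

text \<open>This characterization reduces the metric axioms to facts about single points.\<close>

lemma hausdorff_metric_le_iff:
  fixes A B :: "'a::metric_space set"
  assumes "A \<noteq> {}" "compact A" "B \<noteq> {}" "compact B"
  shows "hausdorff_metric A B \<le> r \<longleftrightarrow> (\<forall>a\<in>A. infdist a B \<le> r) \<and> (\<forall>b\<in>B. infdist b A \<le> r)"
  using assms by (simp add: hausdorff_metric_def cSUP_le_iff bdd_above_infdist_image)

lemma infdist_le_hausdorff_metric:
  fixes A B :: "'a::metric_space set"
  assumes "A \<noteq> {}" "compact A" "B \<noteq> {}" "compact B"
  shows "a \<in> A \<Longrightarrow> infdist a B \<le> hausdorff_metric A B"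
    and "b \<in> B \<Longrightarrow> infdist b A \<le> hausdorff_metric A B"
  using hausdorff_metric_le_iff[OF assms, of "hausdorff_metric A B"] by auto

lemma hausdorff_metric_commute: "hausdorff_metric A B = hausdorff_metric B A"
  by (simp add: hausdorff_metric_def max.commute)

lemma hausdorff_metric_nonneg:
  fixes A B :: "'a::metric_space set"
  assumes "A \<noteq> {}" "compact A" "B \<noteq> {}" "compact B"
  shows "0 \<le> hausdorff_metric A B"
proof -
  obtain a where "a \<in> A"
    using assms by blast
  then show ?thesis
    using infdist_le_hausdorff_metric(1)[OF assms, of a] infdist_nonneg[of a B] by linarith
qed

lemma hausdorff_metric_eq_0_iff:
  fixes A B :: "'a::metric_space set"
  assumes "A \<noteq> {}" "compact A" "B \<noteq> {}" "compact B"
  shows "hausdorff_metric A B = 0 \<longleftrightarrow> A = B"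
proof
  assume "hausdorff_metric A B = 0"
  then have "infdist a B = 0" if "a \<in> A" for a
    using infdist_le_hausdorff_metric(1)[OF assms that] by (simp add: antisym infdist_nonneg)
  moreover have "infdist b A = 0" if "b \<in> B" for b
    using infdist_le_hausdorff_metric(2)[OF assms that] \<open>hausdorff_metric A B = 0\<close>
    by (simp add: antisym infdist_nonneg)
  ultimately show "A = B"
    using in_closed_iff_infdist_zero[of A] in_closed_iff_infdist_zero[of B] assms
    by (metis compact_imp_closed subsetI subset_antisym)
next
  assume "A = B"
  then have "hausdorff_metric A B \<le> 0"
    using assms by (subst hausdorff_metric_le_iff) auto
  then show "hausdorff_metric A B = 0"
    using hausdorff_metric_nonneg[OF assms] by linarith
qed

lemma infdist_le_add_hausdorff_metric:
  fixes B C :: "'a::metric_space set"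
  assumes B: "B \<noteq> {}" "compact B" and C: "C \<noteq> {}" "compact C"
  shows "infdist a C \<le> infdist a B + hausdorff_metric B C"
proof -
  have "infdist a C - hausdorff_metric B C \<le> dist a b" if "b \<in> B" for b
    using infdist_triangle[of a C b] infdist_le_hausdorff_metric(1)[OF B C that] by linarith
  then have "infdist a C - hausdorff_metric B C \<le> infdist a B"
    using B by (simp add: infdist_notempty cINF_greatest)
  then show ?thesis
    by linarith
qed

lemma hausdorff_metric_triangle:
  fixes A B C :: "'a::metric_space set"
  assumes A: "A \<noteq> {}" "compact A" and B: "B \<noteq> {}" "compact B" and C: "C \<noteq> {}" "compact C"
  shows "hausdorff_metric A C \<le> hausdorff_metric A B + hausdorff_metric B C"
proof -
  have "infdist a C \<le> hausdorff_metric A B + hausdorff_metric B C" if "a \<in> A" for a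
    using infdist_le_add_hausdorff_metric[OF B C, of a] infdist_le_hausdorff_metric(1)[OF A B that]
    by linarith
  moreover have "infdist c A \<le> hausdorff_metric A B + hausdorff_metric B C" if "c \<in> C" for c
    using infdist_le_add_hausdorff_metric[OF B A, of c] infdist_le_hausdorff_metric(2)[OF B C that]
    by (simp add: hausdorff_metric_commute)
  ultimately show ?thesis
    by (simp add: hausdorff_metric_le_iff[OF A C])
qed


section \<open>Neighbourhoods and metrizability for uniform convergence on compact sets\<close>

text \<open>The set \<open>W[K,\<epsilon>][F]\<close> need not be open, because a supremum over \<open>K\<close> of distances below \<open>\<epsilon>\<close> can
  equal \<open>\<epsilon>\<close>. The maps that keep some positive margin form an open set inside it.\<close>

lemma uc_entourage_contains_open:
  fixes F :: "'a::topological_space \<Rightarrow> 'b::metric_space set"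
  assumes F: "F \<in> compact_valued_maps" and K: "compact K" and "0 < \<epsilon>"
  obtains T where "openin uc_topology T" "F \<in> T" "T \<subseteq> uc_entourage K \<epsilon> `` {F}"
proof -
  define T where "T = {G \<in> compact_valued_maps. \<exists>\<delta>>0. \<forall>x\<in>K. hausdorff_metric (F x) (G x) \<le> \<epsilon> - \<delta>}"
  have "\<exists>L \<eta>. compact L \<and> 0 < \<eta> \<and> uc_entourage L \<eta> `` {G} \<subseteq> T" if G: "G \<in> T" for G
  proof -
    obtain \<delta> where G: "G \<in> compact_valued_maps" and "0 < \<delta>"
      and \<delta>: "\<forall>x\<in>K. hausdorff_metric (F x) (G x) \<le> \<epsilon> - \<delta>"
      using G unfolding T_def by blast
    have "H \<in> T" if H: "H \<in> uc_entourage K (\<delta>/2) `` {G}" for H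
    proof -
      have H: "H \<in> compact_valued_maps" and GH: "\<forall>x\<in>K. hausdorff_metric (G x) (H x) < \<delta>/2"
        using that by (auto simp: uc_entourage_def)
      have "hausdorff_metric (F x) (H x) \<le> \<epsilon> - \<delta>/2" if "x \<in> K" for x
      proof -
        have "hausdorff_metric (F x) (H x) \<le> hausdorff_metric (F x) (G x) + hausdorff_metric (G x) (H x)"
          using F G H by (intro hausdorff_metric_triangle) (auto simp: compact_valued_maps_def)
        moreover have "hausdorff_metric (F x) (G x) \<le> \<epsilon> - \<delta>" "hausdorff_metric (G x) (H x) < \<delta>/2"
          using \<delta> GH that by blast+
        ultimately show ?thesis
          by linarith
      qed
      moreover have "0 < \<delta>/2"
        using \<open>0 < \<delta>\<close> by simp
      ultimately show ?thesis
        using H unfolding T_def by (intro CollectI conjI exI[of _ "\<delta>/2"] ballI)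
    qed
    moreover have "0 < \<delta>/2"
      using \<open>0 < \<delta>\<close> by simp
    ultimately show ?thesis
      using K by (intro exI[of _ K] exI[of _ "\<delta>/2"] conjI subsetI)
  qed
  moreover have "T \<subseteq> compact_valued_maps"
    unfolding T_def by (rule Collect_restrict)
  ultimately have "openin uc_topology T"
    unfolding openin_uc_topology by (intro conjI ballI)
  have "hausdorff_metric (F x) (F x) = 0" for x
    using F by (subst hausdorff_metric_eq_0_iff) (auto simp: compact_valued_maps_def)
  then have "\<forall>x\<in>K. hausdorff_metric (F x) (F x) \<le> \<epsilon> - \<epsilon>"
    by simp
  then have "F \<in> T"
    using F \<open>0 < \<epsilon>\<close> unfolding T_def by blast
  have "T \<subseteq> uc_entourage K \<epsilon> `` {F}"
  proof
    fix G assume "G \<in> T"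
    then obtain \<delta> where "G \<in> compact_valued_maps" "0 < \<delta>"
      and \<delta>: "\<And>x. x \<in> K \<Longrightarrow> hausdorff_metric (F x) (G x) \<le> \<epsilon> - \<delta>"
      unfolding T_def by blast
    moreover from this have "hausdorff_metric (F x) (G x) < \<epsilon>" if "x \<in> K" for x
      using \<delta>[OF that] by linarith
    ultimately show "G \<in> uc_entourage K \<epsilon> `` {F}"
      using F by (auto simp: uc_entourage_def)
  qed
  show thesis
    by (rule that) fact+
qed

text \<open>Membership in the closure of a set of minimal usco maps can thus be tested on the basic
  entourages.\<close>

lemma MU_closure_of_iff:
  fixes F :: "'a::topological_space \<Rightarrow> 'b::metric_space set"
  assumes A: "A \<subseteq> {F. minimal_usco F}"
  shows "F \<in> MU closure_of A \<longleftrightarrow> minimal_usco F \<and>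
    (\<forall>K \<epsilon>. compact K \<and> 0 < \<epsilon> \<longrightarrow> (\<exists>G\<in>A. \<forall>x\<in>K. hausdorff_metric (F x) (G x) < \<epsilon>))"
    (is "?L \<longleftrightarrow> ?R")
proof
  assume L: ?L
  then have F: "minimal_usco F" and meets: "\<And>T. F \<in> T \<Longrightarrow> openin MU T \<Longrightarrow> \<exists>G. G \<in> A \<and> G \<in> T"
    by (auto simp: in_closure_of)
  show ?R
  proof (intro conjI allI impI)
    show "minimal_usco F"
      by (rule F)
    fix K :: "'a set" and \<epsilon> :: real
    assume "compact K \<and> 0 < \<epsilon>"
    then have K: "compact K" "0 < \<epsilon>"
      by auto
    have "F \<in> compact_valued_maps"
      using F by (auto simp: minimal_usco_def usco_def compact_valued_maps_def)
    then obtain T where T: "openin uc_topology T" "F \<in> T" "T \<subseteq> uc_entourage K \<epsilon> `` {F}"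
      by (rule uc_entourage_contains_open[OF _ K])
    have "openin MU (T \<inter> {F. minimal_usco F})"
      unfolding MU_def by (rule openin_subtopology_Int[OF T(1)])
    moreover have "F \<in> T \<inter> {F. minimal_usco F}"
      using F T(2) by simp
    ultimately obtain G where "G \<in> A" "G \<in> T"
      using meets[of "T \<inter> {F. minimal_usco F}"] by auto
    then have "(F, G) \<in> uc_entourage K \<epsilon>"
      using T(3) by auto
    then show "\<exists>G\<in>A. \<forall>x\<in>K. hausdorff_metric (F x) (G x) < \<epsilon>"
      using \<open>G \<in> A\<close> by (auto simp: uc_entourage_def)
  qed
next
  assume R: ?R
  have "\<exists>G. G \<in> A \<and> G \<in> T" if "F \<in> T" and T: "openin MU T" for T
  proof -
    obtain S where S: "openin uc_topology S" and TS: "T = S \<inter> {F. minimal_usco F}"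
      using T by (auto simp: MU_def openin_subtopology)
    then have "\<exists>K \<epsilon>. compact K \<and> 0 < \<epsilon> \<and> uc_entourage K \<epsilon> `` {F} \<subseteq> S"
      using \<open>F \<in> T\<close> unfolding openin_uc_topology by simp
    then obtain K \<epsilon> where K: "compact K" "0 < \<epsilon>" "uc_entourage K \<epsilon> `` {F} \<subseteq> S"
      by (elim exE conjE)
    then have "\<exists>G\<in>A. \<forall>x\<in>K. hausdorff_metric (F x) (G x) < \<epsilon>"
      using R by simp
    then obtain G where "G \<in> A" and G: "\<forall>x\<in>K. hausdorff_metric (F x) (G x) < \<epsilon>"
      by (elim bexE)
    then have "minimal_usco G"
      using A by auto
    then have "(F, G) \<in> uc_entourage K \<epsilon>"
      using R G by (simp add: uc_entourage_def minimal_usco_def usco_def compact_valued_maps_def)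
    then have "G \<in> T"
      using K(3) \<open>minimal_usco G\<close> TS by auto
    then show ?thesis
      using \<open>G \<in> A\<close> by (intro exI conjI)
  qed
  then show ?L
    using R by (simp add: in_closure_of)
qed

text \<open>Truncating the distance at \<open>x\<close> by \<open>w x\<close> makes the points with \<open>w x < \<epsilon>\<close> irrelevant at scale
  \<open>\<epsilon>\<close>, so only the compact set \<open>L\<close> matters there. On a compact \<open>K\<close> with \<open>\<epsilon> \<le> w\<close>, truncation does
  not affect distances below \<open>\<epsilon>\<close>.\<close>

lemma metrizable_uc_topology_if_weight:
  fixes w :: "'a::topological_space \<Rightarrow> real"
  assumes pos: "\<And>x. 0 < w x" and bounded: "\<And>x. w x \<le> 1"
    and large: "\<And>\<epsilon>. 0 < \<epsilon> \<Longrightarrow> \<exists>L. compact L \<and> (\<forall>x. \<epsilon> \<le> w x \<longrightarrow> x \<in> L)"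
    and below: "\<And>K. compact K \<Longrightarrow> \<exists>\<epsilon>>0. \<forall>x\<in>K. \<epsilon> \<le> w x"
  shows "metrizable_space (uc_topology :: ('a \<Rightarrow> 'b::metric_space set) topology)"
proof -
  let ?M = "compact_valued_maps :: ('a \<Rightarrow> 'b set) set"
  let ?h = "\<lambda>F G x. hausdorff_metric (F x) (G x) :: real"
  (* A metric space in the library sense has nonnegative distances even off its carrier, where the
     suprema in the Hausdorff metric can be negative; hence the absolute value. *)
  let ?g = "\<lambda>(F :: 'a \<Rightarrow> 'b set) G x. min (w x) \<bar>?h F G x\<bar>"
  define D where "D = (\<lambda>F G. SUP x. ?g F G x)"
  have bdd: "bdd_above (range (?g F G))" for F G
    using bounded by (auto intro!: bdd_aboveI[of _ 1] simp: min.coboundedI1)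
  have le_D: "?g F G x \<le> D F G" for F G x
    unfolding D_def by (intro cSUP_upper bdd) simp
  have D_le: "D F G \<le> r" if "\<And>x. ?g F G x \<le> r" for F G r
    unfolding D_def using that by (intro cSUP_least) auto
  have D_nonneg: "0 \<le> D F G" for F G
    using le_D[of undefined F G] pos[of undefined] by linarith
  have M: "F x \<noteq> {}" "compact (F x)" if "F \<in> ?M" for F x
    using that by (auto simp: compact_valued_maps_def)
  have h_nonneg: "0 \<le> ?h F G x" if "F \<in> ?M" "G \<in> ?M" for F G x
    using that M by (simp add: hausdorff_metric_nonneg)
  have h_triangle: "?h F H x \<le> ?h F G x + ?h G H x" if "F \<in> ?M" "G \<in> ?M" "H \<in> ?M" for F G H x
    using that M by (intro hausdorff_metric_triangle)
  interpret D: Metric_space ?M D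
  proof
    show "0 \<le> D F G" for F G
      by (rule D_nonneg)
    show "D F G = D G F" for F G
      by (simp add: D_def hausdorff_metric_commute)
    show "D F G = 0 \<longleftrightarrow> F = G" if "F \<in> ?M" "G \<in> ?M" for F G
    proof
      assume "D F G = 0"
      then have "?h F G x = 0" for x
        using le_D[of x F G] pos[of x] by linarith
      then show "F = G"
        using that M by (simp add: hausdorff_metric_eq_0_iff fun_eq_iff)
    next
      assume "F = G"
      then have "?h F G x = 0" for x
        using that M by (simp add: hausdorff_metric_eq_0_iff)
      then have "D F G \<le> 0"
        by (intro D_le) simp
      then show "D F G = 0"
        using D_nonneg[of F G] by linarith
    qed
    show "D F H \<le> D F G + D G H" if "F \<in> ?M" "G \<in> ?M" "H \<in> ?M" for F G H
    proof (rule D_le)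
      fix x
      have "?g F H x \<le> ?g F G x + ?g G H x"
        using h_triangle[OF that, of x] h_nonneg[OF that(1,3), of x] pos[of x] by linarith
      then show "?g F H x \<le> D F G + D G H"
        using le_D[of x F G] le_D[of x G H] by linarith
    qed
  qed
  have entourage_in_ball: "\<exists>K \<epsilon>. compact K \<and> 0 < \<epsilon> \<and> uc_entourage K \<epsilon> `` {F} \<subseteq> D.mball F r"
    if "0 < r" for F r
  proof -
    obtain L where L: "compact L" "\<And>x. r/2 \<le> w x \<Longrightarrow> x \<in> L"
      using large[of "r/2"] \<open>0 < r\<close> by auto
    have "uc_entourage L (r/2) `` {F} \<subseteq> D.mball F r"
    proof
      fix G assume "G \<in> uc_entourage L (r/2) `` {F}"
      then have FG: "F \<in> ?M" "G \<in> ?M" and *: "\<And>x. x \<in> L \<Longrightarrow> ?h F G x < r/2"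
        by (auto simp: uc_entourage_def)
      have "?g F G x \<le> r/2" for x
        using L(2)[of x] *[of x] h_nonneg[OF FG, of x] by linarith
      then have "D F G \<le> r/2"
        by (rule D_le)
      then show "G \<in> D.mball F r"
        using FG \<open>0 < r\<close> by simp
    qed
    then show ?thesis
      using L \<open>0 < r\<close> by (metis half_gt_zero)
  qed
  have ball_in_entourage: "\<exists>r>0. D.mball F r \<subseteq> uc_entourage K \<epsilon> `` {F}"
    if "compact K" "0 < \<epsilon>" for F K and \<epsilon> :: real
  proof -
    obtain \<delta> where \<delta>: "0 < \<delta>" "\<And>x. x \<in> K \<Longrightarrow> \<delta> \<le> w x"
      using below[OF \<open>compact K\<close>] by blast
    have "D.mball F (min \<delta> \<epsilon>) \<subseteq> uc_entourage K \<epsilon> `` {F}"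
    proof
      fix G assume "G \<in> D.mball F (min \<delta> \<epsilon>)"
      then have FG: "F \<in> ?M" "G \<in> ?M" and *: "D F G < \<delta>" "D F G < \<epsilon>"
        by auto
      have "?h F G x < \<epsilon>" if "x \<in> K" for x
        using le_D[of x F G] \<delta>(2)[OF that] * by linarith
      then show "G \<in> uc_entourage K \<epsilon> `` {F}"
        using FG by (auto simp: uc_entourage_def)
    qed
    then show ?thesis
      using \<delta> \<open>0 < \<epsilon>\<close> by (metis min_less_iff_conj)
  qed
  have "openin uc_topology \<U> \<longleftrightarrow> openin D.mtopology \<U>" for \<U>
    unfolding openin_uc_topology D.openin_mtopology
    using entourage_in_ball ball_in_entourage by (meson subset_trans)
  then have "uc_topology = D.mtopology"
    by (simp add: topology_eq)
  then show ?thesis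
    using D.metrizable_space_mtopology by simp
qed

lemma hemicompact_imp_metrizable_uc_topology:
  assumes "hemicompact_space (euclidean :: 'a::topological_space topology)"
  shows "metrizable_space (uc_topology :: ('a \<Rightarrow> 'b::metric_space set) topology)"
proof -
  obtain \<C> :: "'a set set" where "countable \<C>" and \<C>: "\<And>C. C \<in> \<C> \<Longrightarrow> compact C"
    and cofinal: "\<And>K. compact K \<Longrightarrow> K \<noteq> {} \<Longrightarrow> \<exists>C\<in>\<C>. K \<subseteq> C"
    using assms by (auto simp: hemicompact_space_def)
  have "\<C> \<noteq> {}"
    using cofinal[of "{undefined}"] by auto
  define C where "C = from_nat_into \<C>"
  have compact_C: "compact (C n)" for n
    using \<C> from_nat_into[OF \<open>\<C> \<noteq> {}\<close>] by (simp add: C_def)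
  have cofinal_C: "\<exists>n. K \<subseteq> C n" if "compact K" for K
    using cofinal[OF that] from_nat_into_surj[OF \<open>countable \<C>\<close>] unfolding C_def
    by (metis empty_subsetI)
  have covers: "\<exists>n. x \<in> C n" for x
    using cofinal_C[of "{x}"] by auto
  define n where "n x = (LEAST n. x \<in> C n)" for x
  have in_C: "x \<in> C (n x)" for x
    unfolding n_def using covers by (rule LeastI_ex)
  have n_le: "n x \<le> k" if "x \<in> C k" for x k
    unfolding n_def using that by (rule Least_le)
  show ?thesis
  proof (rule metrizable_uc_topology_if_weight)
    fix x
    show "0 < 1 / real (Suc (n x))" "1 / real (Suc (n x)) \<le> 1"
      by auto
  next
    fix \<epsilon> :: real assume "0 < \<epsilon>"
    then obtain N where N: "inverse (real (Suc N)) < \<epsilon>"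
      using reals_Archimedean by blast
    have "x \<in> (\<Union>i\<le>N. C i)" if "\<epsilon> \<le> 1 / real (Suc (n x))" for x
    proof -
      have "1 / real (Suc N) < 1 / real (Suc (n x))"
        using N that by (simp add: inverse_eq_divide)
      then have "n x \<le> N"
        by (simp add: field_simps)
      then show ?thesis
        using in_C by blast
    qed
    moreover have "compact (\<Union>i\<le>N. C i)"
      using compact_C by (intro compact_UN) auto
    ultimately show "\<exists>L. compact L \<and> (\<forall>x. \<epsilon> \<le> 1 / real (Suc (n x)) \<longrightarrow> x \<in> L)"
      by blast
  next
    fix K :: "'a set" assume "compact K"
    then obtain k where "K \<subseteq> C k"
      using cofinal_C by blast
    then have "\<forall>x\<in>K. 1 / real (Suc k) \<le> 1 / real (Suc (n x))"
      using n_le by (intro ballI divide_left_mono) auto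
    then show "\<exists>\<epsilon>>0. \<forall>x\<in>K. \<epsilon> \<le> 1 / real (Suc (n x))"
      by (intro exI[of _ "1 / real (Suc k)"]) auto
  qed
qed


section \<open>Minimal usco maps with two values\<close>

definition two_valued_usco :: "'b \<Rightarrow> 'b \<Rightarrow> 'a::topological_space set \<Rightarrow> 'a \<Rightarrow> 'b set" where
  "two_valued_usco a b U x = {y. y = a \<and> x \<in> closure U \<or> y = b \<and> x \<in> closure (- closure U)}"

text \<open>Usco maps to a \<open>T\<^sub>1\<close> space have closed level sets: otherwise the complement of \<open>y\<close> would be a
  neighbourhood of \<open>G x\<close> that no nearby value \<open>G s\<close> with \<open>s \<in> S\<close> respects.\<close>

lemma usco_value_at_closure:
  fixes G :: "'a::topological_space \<Rightarrow> 'b::t1_space set"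
  assumes "usco G" "\<And>s. s \<in> S \<Longrightarrow> y \<in> G s" "x \<in> closure S"
  shows "y \<in> G x"
proof (rule ccontr)
  assume "y \<notin> G x"
  then have "open (- {y})" "G x \<subseteq> - {y}"
    by auto
  then obtain U where "open U" "x \<in> U" "(\<Union>u\<in>U. G u) \<subseteq> - {y}"
    using \<open>usco G\<close> unfolding usco_def upper_semicontinuous_def by meson
  moreover from this obtain s where "s \<in> S" "s \<in> U"
    using \<open>x \<in> closure S\<close> open_Int_closure_eq_empty[of U S] by blast
  ultimately show False
    using assms(2) by blast
qed

lemma usco_two_valued_usco:
  fixes a b :: "'b::topological_space"
  shows "usco (two_valued_usco a b U)"
  unfolding usco_def
proof
  show "upper_semicontinuous (two_valued_usco a b U)"
    unfolding upper_semicontinuous_def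
  proof (intro allI impI)
    fix x V assume V: "open V \<and> two_valued_usco a b U x \<subseteq> V"
    (* Stay away from the closed set on which a value outside V is attained. *)
    let ?N = "(if a \<in> V then UNIV else - closure U) \<inter>
      (if b \<in> V then UNIV else - closure (- closure U))"
    have "open ?N" "x \<in> ?N" "(\<Union>u\<in>?N. two_valued_usco a b U u) \<subseteq> V"
      using V by (auto simp: two_valued_usco_def open_Compl split: if_splits)
    then show "\<exists>W. open W \<and> x \<in> W \<and> (\<Union>u\<in>W. two_valued_usco a b U u) \<subseteq> V"
      by blast
  qed
  show "\<forall>x. two_valued_usco a b U x \<noteq> {} \<and> compact (two_valued_usco a b U x)"
  proof
    fix x
    have "two_valued_usco a b U x \<subseteq> {a, b}"
      by (auto simp: two_valued_usco_def)
    then have "compact (two_valued_usco a b U x)"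
      by (intro finite_imp_compact) (auto intro: finite_subset)
    moreover have "two_valued_usco a b U x \<noteq> {}"
      using closure_subset[of "- closure U"] by (auto simp: two_valued_usco_def)
    ultimately show "two_valued_usco a b U x \<noteq> {} \<and> compact (two_valued_usco a b U x)"
      by blast
  qed
qed

lemma two_valued_usco_inside:
  assumes "open U" "x \<in> U"
  shows "two_valued_usco a b U x = {a}"
proof -
  have "U \<inter> (- closure U) = {}"
    using closure_subset[of U] by blast
  then have "U \<inter> closure (- closure U) = {}"
    using open_Int_closure_eq_empty[OF \<open>open U\<close>] by blast
  then show ?thesis
    using assms closure_subset[of U] by (auto simp: two_valued_usco_def)
qed

lemma two_valued_usco_outside:
  assumes "x \<notin> closure U"
  shows "two_valued_usco a b U x = {b}"
  using assms closure_subset[of "- closure U"] by (auto simp: two_valued_usco_def)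

text \<open>The map is single-valued on \<open>U\<close> and off \<open>closure U\<close>, so a smaller usco map \<open>G\<close> agrees with it
  there. All other values are then forced, as level sets of \<open>G\<close> are closed.\<close>

lemma minimal_usco_two_valued_usco:
  fixes a b :: "'b::t1_space"
  assumes "open U"
  shows "minimal_usco (two_valued_usco a b U)"
  unfolding minimal_usco_def
proof (intro conjI notI)
  show "usco (two_valued_usco a b U)"
    by (rule usco_two_valued_usco)
  assume "\<exists>G. usco G \<and> graph_of G \<subset> graph_of (two_valued_usco a b U)"
  then obtain G where G: "usco G" and sub: "graph_of G \<subset> graph_of (two_valued_usco a b U)"
    by blast
  have le: "G x \<subseteq> two_valued_usco a b U x" for x
    using sub by (auto simp: graph_of_def)
  have ne: "G x \<noteq> {}" for x
    using G by (simp add: usco_def)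
  have "a \<in> G s" if "s \<in> U" for s
    using le[of s] ne[of s] unfolding two_valued_usco_inside[OF \<open>open U\<close> that] by blast
  then have a: "a \<in> G x" if "x \<in> closure U" for x
    using usco_value_at_closure[OF G] that by blast
  have "b \<in> G s" if "s \<in> - closure U" for s
    using le[of s] ne[of s] two_valued_usco_outside[of s U a b] that by auto
  then have b: "b \<in> G x" if "x \<in> closure (- closure U)" for x
    using usco_value_at_closure[OF G] that by blast
  have "two_valued_usco a b U x \<subseteq> G x" for x
    using a b by (auto simp: two_valued_usco_def)
  then show False
    using sub by (auto simp: graph_of_def)
qed


section \<open>Countable tightness forces hemicompactness\<close>

lemma compact_subset_open_compact_closure:
  fixes K :: "'a::t2_space set"
  assumes lc: "locally_compact_space (euclidean :: 'a topology)" and K: "compact K"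
  obtains U where "open U" "K \<subseteq> U" "compact (closure U)"
proof -
  have "\<exists>V L. open V \<and> compact L \<and> x \<in> V \<and> V \<subseteq> L" for x :: 'a
    using lc by (simp add: locally_compact_space_def)
  then obtain V L where V: "\<And>x :: 'a. open (V x) \<and> compact (L x) \<and> x \<in> V x \<and> V x \<subseteq> L x"
    by metis
  have "K \<subseteq> (\<Union>x\<in>K. V x)"
    using V by blast
  then obtain I where I: "I \<subseteq> K" "finite I" "K \<subseteq> (\<Union>x\<in>I. V x)"
    using compactE_image[OF K, of K V] V by metis
  have L: "compact (\<Union>x\<in>I. L x)"
    using I V by (intro compact_UN) auto
  have "closure (\<Union>x\<in>I. V x) \<subseteq> (\<Union>x\<in>I. L x)"
    using V by (intro closure_minimal compact_imp_closed L) blast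
  then have "compact (closure (\<Union>x\<in>I. V x))"
    using compact_Int_closed[OF L closed_closure, of "\<Union>x\<in>I. V x"] by (simp add: inf.absorb2)
  moreover have "open (\<Union>x\<in>I. V x)"
    using V by blast
  ultimately show thesis
    using that I by blast
qed

lemma countable_tightness_imp_hemicompact:
  fixes a b :: "'b::metric_space"
  assumes lc: "locally_compact_space (euclidean :: 'a::t2_space topology)" and "a \<noteq> b"
    and tight: "countable_tightness (MU :: ('a \<Rightarrow> 'b set) topology)"
  shows "hemicompact_space (euclidean :: 'a topology)"
proof -
  let ?\<U> = "{U :: 'a set. open U \<and> compact (closure U)}"
  let ?A = "two_valued_usco a b ` ?\<U>"
  let ?c = "(\<lambda>_. {a}) :: 'a \<Rightarrow> 'b set"
  have A: "?A \<subseteq> {F. minimal_usco F}"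
    by (auto intro: minimal_usco_two_valued_usco)
  have "two_valued_usco a b UNIV = ?c"
    by (rule ext) (rule two_valued_usco_inside[OF open_UNIV UNIV_I])
  with minimal_usco_two_valued_usco[OF open_UNIV] have "minimal_usco ?c"
    by (rule back_subst)
  moreover have "\<exists>G\<in>?A. \<forall>x\<in>K. hausdorff_metric (?c x) (G x) < \<epsilon>"
    if "compact K" "0 < \<epsilon>" for K and \<epsilon> :: real
  proof -
    obtain U where U: "open U" "K \<subseteq> U" "compact (closure U)"
      using compact_subset_open_compact_closure[OF lc \<open>compact K\<close>] .
    have "two_valued_usco a b U x = {a}" if "x \<in> K" for x
      by (rule two_valued_usco_inside[OF U(1)]) (use U(2) that in blast)
    moreover have "hausdorff_metric {a} {a} = 0"
      by (subst hausdorff_metric_eq_0_iff) auto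
    ultimately have "\<forall>x\<in>K. hausdorff_metric (?c x) (two_valued_usco a b U x) < \<epsilon>"
      using \<open>0 < \<epsilon>\<close> by simp
    then show ?thesis
      using U by blast
  qed
  ultimately have "?c \<in> MU closure_of ?A"
    by (subst MU_closure_of_iff[OF A]) (intro conjI allI impI; simp only:)
  then obtain A0 where A0: "A0 \<subseteq> ?A" "countable A0" "?c \<in> MU closure_of A0"
    using tight A unfolding countable_tightness_def topspace_MU by meson
  then obtain \<V> where \<V>: "\<V> \<subseteq> ?\<U>" "countable \<V>" "A0 = two_valued_usco a b ` \<V>"
    by (meson countable_subset_image)
  have cofinal: "\<exists>U\<in>\<V>. K \<subseteq> closure U" if "compact K" for K
  proof -
    have "A0 \<subseteq> {F. minimal_usco F}"
      using A0 A by blast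
    moreover have "0 < dist a b"
      using \<open>a \<noteq> b\<close> by simp
    ultimately have "\<exists>G\<in>A0. \<forall>x\<in>K. hausdorff_metric (?c x) (G x) < dist a b"
      using A0(3) MU_closure_of_iff[of A0 ?c] that by blast
    then obtain U where "U \<in> \<V>"
      and U: "\<forall>x\<in>K. hausdorff_metric {a} (two_valued_usco a b U x) < dist a b"
      using \<V> by blast
    have "x \<in> closure U" if "x \<in> K" for x
    proof (rule ccontr)
      assume "x \<notin> closure U"
      then have "hausdorff_metric {a} {b} < dist a b"
        using U that by (metis two_valued_usco_outside)
      moreover have "infdist a {b} \<le> hausdorff_metric {a} {b}"
        by (rule infdist_le_hausdorff_metric) auto
      ultimately show False
        by simp
    qed
    then show ?thesis
      using \<open>U \<in> \<V>\<close> by blast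
  qed
  show ?thesis
    unfolding hemicompact_space_def
  proof (intro exI[of _ "closure ` \<V> - {{}}"] conjI allI impI)
    show "countable (closure ` \<V> - {{}})"
      using \<V> by simp
    show "closure ` \<V> - {{}} \<subseteq> {K. compactin euclidean K \<and> K \<noteq> {}}"
      using \<V> by auto
    fix K :: "'a set" assume K: "compactin euclidean K \<and> K \<noteq> {}"
    then obtain U where "U \<in> \<V>" "K \<subseteq> closure U"
      using cofinal by auto
    then show "\<exists>C\<in>closure ` \<V> - {{}}. K \<subseteq> C"
      using K by (intro bexI[of _ "closure U"]) auto
  qed
qed


section \<open>Countability properties of arbitrary topological spaces\<close>

lemma first_countable_imp_Frechet_Urysohn:
  assumes "first_countable Z"
  shows "Frechet_Urysohn_space Z"
  unfolding Frechet_Urysohn_space_def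
proof (intro allI impI)
  fix E z assume Ez: "E \<subseteq> topspace Z \<and> z \<in> Z closure_of E"
  then have z: "z \<in> topspace Z"
    by (simp add: in_closure_of)
  then obtain \<B> where \<B>: "countable \<B>" "\<forall>V\<in>\<B>. openin Z V"
    "\<And>U. openin Z U \<Longrightarrow> z \<in> U \<Longrightarrow> \<exists>V\<in>\<B>. z \<in> V \<and> V \<subseteq> U"
    using assms unfolding first_countable_def by meson
  define \<N> where "\<N> = {V \<in> \<B>. z \<in> V}"
  have "\<N> \<noteq> {}"
    using \<B>(3)[OF openin_topspace z] by (auto simp: \<N>_def)
  have "countable \<N>"
    using \<B>(1) by (simp add: \<N>_def)
  define V where "V = from_nat_into \<N>"
  have V: "openin Z (V n)" "z \<in> V n" for n
    using from_nat_into[OF \<open>\<N> \<noteq> {}\<close>, of n] \<B>(2) by (auto simp: V_def \<N>_def)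
  (* Intersecting initial segments makes the neighbourhoods decreasing. *)
  have "\<exists>y. y \<in> E \<and> y \<in> (\<Inter>i\<le>n. V i)" for n
  proof -
    have meets: "\<exists>y. y \<in> E \<and> y \<in> T" if "openin Z T" "z \<in> T" for T
      using Ez that unfolding in_closure_of by blast
    have "openin Z (\<Inter>i\<le>n. V i)"
      by (rule openin_INT2) (simp_all add: V(1))
    then show ?thesis
      by (rule meets) (simp add: V(2))
  qed
  then obtain s where s: "\<And>n. s n \<in> E \<and> s n \<in> (\<Inter>i\<le>n. V i)"
    by metis
  have "limitin Z s z sequentially"
    unfolding limitin_def
  proof (intro conjI allI impI)
    fix U assume "openin Z U \<and> z \<in> U"
    then obtain W where "W \<in> \<N>" "W \<subseteq> U"
      using \<B>(3) by (auto simp: \<N>_def)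
    then obtain k where k: "V k \<subseteq> U"
      using from_nat_into_surj[OF \<open>countable \<N>\<close> \<open>W \<in> \<N>\<close>] by (auto simp: V_def)
    have "s n \<in> U" if "k \<le> n" for n
    proof -
      have "s n \<in> V k"
        using s[of n] that by simp
      then show ?thesis
        using k by blast
    qed
    then show "eventually (\<lambda>n. s n \<in> U) sequentially"
      by (auto simp: eventually_sequentially)
  qed (rule z)
  then show "\<exists>s :: nat \<Rightarrow> _. range s \<subseteq> E \<and> limitin Z s z sequentially"
    using s by blast
qed

lemma Frechet_Urysohn_imp_sequential:
  assumes "Frechet_Urysohn_space Z"
  shows "sequential_space Z"
  unfolding sequential_space_def
proof (intro allI impI)
  fix A assume A: "A \<subseteq> topspace Z \<and> \<not> closedin Z A"
  then obtain z where "z \<in> Z closure_of A" "z \<notin> A"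
    by (metis closure_of_subset_eq subsetI)
  then show "\<exists>(s :: nat \<Rightarrow> _) z. range s \<subseteq> A \<and> limitin Z s z sequentially \<and> z \<notin> A"
    using assms A unfolding Frechet_Urysohn_space_def by metis
qed

text \<open>The points in the closure of some countable subset of \<open>A\<close> form a sequentially closed set: if a
  sequence runs in it, the union of the countable witnesses is again countable and has the limit in
  its closure. In a sequential space that set is closed, and so it is the whole closure of \<open>A\<close>.\<close>

lemma sequential_imp_countable_tightness:
  assumes "sequential_space Z"
  shows "countable_tightness Z"
  unfolding countable_tightness_def
proof (intro allI impI)
  fix A z assume Az: "A \<subseteq> topspace Z \<and> z \<in> Z closure_of A"
  define B where "B = {x. \<exists>A0\<subseteq>A. countable A0 \<and> x \<in> Z closure_of A0}"
  have "closedin Z B"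
  proof (rule ccontr)
    assume "\<not> closedin Z B"
    moreover have "B \<subseteq> topspace Z"
      using closure_of_subset_topspace by (fastforce simp: B_def)
    ultimately obtain s :: "nat \<Rightarrow> _" and l
      where s: "range s \<subseteq> B" "limitin Z s l sequentially" "l \<notin> B"
      using assms unfolding sequential_space_def by meson
    then have "\<forall>n. \<exists>A0\<subseteq>A. countable A0 \<and> s n \<in> Z closure_of A0"
      by (auto simp: B_def)
    then obtain C where C: "\<And>n. C n \<subseteq> A \<and> countable (C n) \<and> s n \<in> Z closure_of (C n)"
      by metis
    have "s n \<in> Z closure_of (\<Union>n. C n)" for n
      using C closure_of_mono[of "C n" "\<Union>n. C n" Z] by blast
    then have "l \<in> Z closure_of (\<Union>n. C n)"
      using s(2) by (intro limitin_closedin[OF s(2) closedin_closure_of]) auto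
    moreover have "(\<Union>n. C n) \<subseteq> A" "countable (\<Union>n. C n)"
      using C by auto
    ultimately show False
      using s(3) unfolding B_def by blast
  qed
  moreover have "A \<subseteq> B"
  proof
    fix x assume "x \<in> A"
    then have "x \<in> Z closure_of {x}"
      using Az by (auto simp: in_closure_of)
    then show "x \<in> B"
      using \<open>x \<in> A\<close> unfolding B_def by (intro CollectI exI[of _ "{x}"]) auto
  qed
  ultimately have "Z closure_of A \<subseteq> B"
    by (rule closure_of_minimal[rotated])
  then show "\<exists>A\<^sub>0. A\<^sub>0 \<subseteq> A \<and> countable A\<^sub>0 \<and> z \<in> Z closure_of A\<^sub>0"
    using Az by (auto simp: B_def)
qed


section \<open>The equivalence\<close>

theorem theorem3p18:
  fixes MU_XY :: "('a::t2_space \<Rightarrow> 'b::metric_space set) topology"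
  defines "MU_XY \<equiv> MU"
  assumes "locally_compact_space (euclidean :: 'a topology)"
    and "\<exists>y\<^sub>1 y\<^sub>2 :: 'b. y\<^sub>1 \<noteq> y\<^sub>2"
  shows "(metrizable_space MU_XY \<longleftrightarrow> first_countable MU_XY) \<and>
    (first_countable MU_XY \<longleftrightarrow> Frechet_Urysohn_space MU_XY) \<and>
    (Frechet_Urysohn_space MU_XY \<longleftrightarrow> sequential_space MU_XY) \<and>
    (sequential_space MU_XY \<longleftrightarrow> countable_tightness MU_XY) \<and>
    (countable_tightness MU_XY \<longleftrightarrow> hemicompact_space (euclidean :: 'a topology))"
proof -
  have "hemicompact_space (euclidean :: 'a topology)" if "countable_tightness MU_XY"
    using countable_tightness_imp_hemicompact[OF assms(2)] assms(3) that
    unfolding MU_XY_def by blast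
  moreover have "metrizable_space MU_XY" if "hemicompact_space (euclidean :: 'a topology)"
    unfolding MU_XY_def MU_def
    by (intro metrizable_space_subtopology hemicompact_imp_metrizable_uc_topology that)
  ultimately show ?thesis
    using metrizable_imp_first_countable first_countable_imp_Frechet_Urysohn
      Frechet_Urysohn_imp_sequential sequential_imp_countable_tightness by blast
qed

end
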